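(* Let $(V,g)$ be a real vector space of dimension $n+1$, $n\in\mathbb N$, with a positive definite inner product $g$ and a unit vector $\xi$; let $U=\mathrm{span}(\xi)$ and $D=U^\perp$. The submodule $\mathcal S_U^1(V)=U^*\otimes D^*\otimes U^*$ of $\mathcal S(V)$ is $\mathrm{SO}(D)$-irreducible, and its explicit expression is $$\mathcal S_U^1(V)=\{S\in\mathcal S(V): S_{XYZ}=g(Y,\eta)\,g(X,\xi)\,g(Z,\xi),\ \eta\in D\}.$$
   Context: $\mathcal S(V)=\{S\in V^*\otimes\mathfrak{gl}(V): S_X\cdot g=0\ \text{for all } X\in D,\ S_\xi\xi=0\}$, where $S_X\cdot g$ denotes the action of the endomorphism $S_X$ on $g$ as a derivation. Spaces and their duals are identified through $g$, with $S_{XYZ}=g(S_XY,Z)$ for $X,Y,Z\in V$. $\mathrm{SO}(D)\cong\mathrm{SO}(n)$ acts on $V=U\oplus D$ fixing $\xi$ and in the standard way on $D$. *)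

theory Defs
  imports "HOL-Analysis.Analysis" "Jordan_Normal_Form.Determinant"
begin

text \<open>
  The inner product space \<open>(V, g)\<close> is a type of class \<open>euclidean_space\<close>, with \<open>g\<close> its inner product.
  All linear maps on it are bounded, so \<open>V \<Rightarrow>\<^sub>L W\<close> is the vector space of all linear maps
  \<open>V \<rightarrow> W\<close>; in particular \<open>V\<^sup>* \<otimes> \<gg>\<ll>(V)\<close> is \<open>V \<Rightarrow>\<^sub>L V \<Rightarrow>\<^sub>L V\<close>, with \<open>S\<^sub>X Y\<close> written
  \<open>blinfun_apply (blinfun_apply S X) Y\<close>.
\<close>

type_synonym 'v tensor = "'v \<Rightarrow>\<^sub>L 'v \<Rightarrow>\<^sub>L 'v"

definition lower :: "'v::euclidean_space tensor \<Rightarrow> 'v \<Rightarrow> 'v \<Rightarrow> 'v \<Rightarrow> real" where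
  "lower S X Y Z = inner (blinfun_apply (blinfun_apply S X) Y) Z"

definition U_space :: "'v::euclidean_space \<Rightarrow> 'v set" where
  "U_space \<xi> = span {\<xi>}"

definition D_space :: "'v::euclidean_space \<Rightarrow> 'v set" where
  "D_space \<xi> = orthogonal_comp (U_space \<xi>)"

definition derivation_action ::
    "('v::euclidean_space \<Rightarrow>\<^sub>L 'v) \<Rightarrow> ('v \<Rightarrow> 'v \<Rightarrow> real) \<Rightarrow> ('v \<Rightarrow> 'v \<Rightarrow> real)" where
  "derivation_action T b =
     (\<lambda>Y Z. - b (blinfun_apply T Y) Z - b Y (blinfun_apply T Z))"

definition S_space :: "'v::euclidean_space \<Rightarrow> 'v tensor set" where
  "S_space \<xi> = {S. (\<forall>X\<in>D_space \<xi>. derivation_action (blinfun_apply S X) inner = (\<lambda>_ _. 0)) \<and>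
                   blinfun_apply (blinfun_apply S \<xi>) \<xi> = 0}"

text \<open>
  For a subspace \<open>W\<close>, the dual \<open>W\<^sup>*\<close> is viewed inside \<open>V\<^sup>*\<close> as the set of functionals
  \<open>g(w, \<cdot>)\<close> with \<open>w \<in> W\<close>, i.e. the functionals on \<open>W\<close> extended by zero on its orthogonal complement.
\<close>

definition dual_space :: "'v::euclidean_space set \<Rightarrow> ('v \<Rightarrow>\<^sub>L real) set" where
  "dual_space W = {\<alpha>. \<exists>w\<in>W. \<forall>x. blinfun_apply \<alpha> x = inner w x}"

text \<open>
  \<open>A \<otimes> B \<otimes> C\<close> for spaces of functionals: the span of the decomposable tensors
  \<open>\<alpha> \<otimes> \<beta> \<otimes> \<gamma>\<close>, transported to \<open>V\<^sup>* \<otimes> \<gg>\<ll>(V)\<close> through \<open>S\<^sub>X\<^sub>Y\<^sub>Z = g(S\<^sub>X Y, Z)\<close>.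
\<close>

definition tensor3 ::
    "('v::euclidean_space \<Rightarrow>\<^sub>L real) set \<Rightarrow> ('v \<Rightarrow>\<^sub>L real) set \<Rightarrow> ('v \<Rightarrow>\<^sub>L real) set \<Rightarrow> 'v tensor set" where
  "tensor3 A B C = span {S. \<exists>\<alpha>\<in>A. \<exists>\<beta>\<in>B. \<exists>\<gamma>\<in>C. \<forall>X Y Z.
     lower S X Y Z = blinfun_apply \<alpha> X * blinfun_apply \<beta> Y * blinfun_apply \<gamma> Z}"

definition S1U_space :: "'v::euclidean_space \<Rightarrow> 'v tensor set" where
  "S1U_space \<xi> =
     tensor3 (dual_space (U_space \<xi>)) (dual_space (D_space \<xi>)) (dual_space (U_space \<xi>))"

definition orthonormal_frame :: "'v::euclidean_space set \<Rightarrow> (nat \<Rightarrow> 'v) \<Rightarrow> bool" where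
  "orthonormal_frame W e \<longleftrightarrow>
     (\<forall>i<dim W. \<forall>j<dim W. inner (e i) (e j) = (if i = j then 1 else 0)) \<and>
     span (e ` {..<dim W}) = W"

definition frame_matrix :: "'v::euclidean_space set \<Rightarrow> (nat \<Rightarrow> 'v) \<Rightarrow> ('v \<Rightarrow> 'v) \<Rightarrow> real mat" where
  "frame_matrix W e A = Matrix.mat (dim W) (dim W) (\<lambda>(i, j). inner (e i) (A (e j)))"

text \<open>
  Each element of \<open>SO(D)\<close> is represented by the linear map it induces on \<open>V = U \<oplus> D\<close>.
  The determinant of a linear map \<open>D \<rightarrow> D\<close> is that of its matrix in any orthonormal frame of \<open>D\<close>,
  so it does not matter that only one frame is asked for.
\<close>

definition SO_D :: "'v::euclidean_space \<Rightarrow> ('v \<Rightarrow> 'v) set" where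
  "SO_D \<xi> = {A. linear A \<and> A \<xi> = \<xi> \<and> A ` D_space \<xi> \<subseteq> D_space \<xi> \<and>
     (\<forall>x\<in>D_space \<xi>. \<forall>y\<in>D_space \<xi>. inner (A x) (A y) = inner x y) \<and>
     (\<exists>e. orthonormal_frame (D_space \<xi>) e \<and>
          Determinant.det (frame_matrix (D_space \<xi>) e A) = 1)}"

text \<open>The natural action, \<open>(A \<cdot> S)\<^sub>X Y = A (S\<^bsub>A\<^sup>-\<^sup>1 X\<^esub> (A\<^sup>-\<^sup>1 Y))\<close>.\<close>

definition tensor_action :: "('v::euclidean_space \<Rightarrow> 'v) \<Rightarrow> 'v tensor \<Rightarrow> 'v tensor" where
  "tensor_action A S =
     Blinfun (\<lambda>X. Blinfun (\<lambda>Y. A (blinfun_apply (blinfun_apply S (inv_into UNIV A X)) (inv_into UNIV A Y))))"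

lemma tensor_action_apply:
  fixes A :: "'v::euclidean_space \<Rightarrow> 'v"
  assumes "linear A" "bij A"
  shows "blinfun_apply (blinfun_apply (tensor_action A S) X) Y =
           A (blinfun_apply (blinfun_apply S (inv_into UNIV A X)) (inv_into UNIV A Y))"
proof -
  interpret A: linear A by fact
  have "linear (inv_into UNIV A)"
    by (rule linearI; rule injD[OF bij_is_inj[OF assms(2)]])
       (simp_all add: A.add A.scale bij_is_surj[OF assms(2)] surj_f_inv_f)
  then interpret B: linear "inv_into UNIV A" .
  have in1: "bounded_linear (\<lambda>Y. A (blinfun_apply (blinfun_apply S (inv_into UNIV A X)) (inv_into UNIV A Y)))" for X
    by (intro linear_conv_bounded_linear[THEN iffD1] linearI)
       (simp_all add: A.add A.scale B.add B.scale blinfun.add_right blinfun.scaleR_right)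
  have out: "bounded_linear (\<lambda>X. Blinfun (\<lambda>Y. A (blinfun_apply (blinfun_apply S (inv_into UNIV A X)) (inv_into UNIV A Y))))"
    (is "bounded_linear ?F")
  proof (intro linear_conv_bounded_linear[THEN iffD1] linearI blinfun_eqI)
    fix X X' Y
    show "blinfun_apply (?F (X + X')) Y = blinfun_apply (?F X + ?F X') Y"
      unfolding blinfun.add_left bounded_linear_Blinfun_apply[OF in1]
      by (simp add: A.add B.add blinfun.add_left blinfun.add_right)
  next
    fix r X Y
    show "blinfun_apply (?F (r *\<^sub>R X)) Y = blinfun_apply (r *\<^sub>R ?F X) Y"
      unfolding blinfun.scaleR_left bounded_linear_Blinfun_apply[OF in1]
      by (simp add: A.scale B.scale blinfun.scaleR_left blinfun.scaleR_right)
  qed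
  show ?thesis
    unfolding tensor_action_def
    by (simp add: bounded_linear_Blinfun_apply[OF out] bounded_linear_Blinfun_apply[OF in1])
qed

lemma SO_D_bij:
  fixes A :: "'v::euclidean_space \<Rightarrow> 'v"
  assumes "A \<in> SO_D \<xi>" "norm \<xi> = 1"
  shows "bij A"
proof -
  have lin: "linear A" and Axi: "A \<xi> = \<xi>" and D: "A ` D_space \<xi> \<subseteq> D_space \<xi>"
    and iso: "\<And>x. x \<in> D_space \<xi> \<Longrightarrow> inner (A x) (A x) = inner x x"
    using assms(1) by (auto simp: SO_D_def)
  interpret A: linear A by fact
  have mem: "y \<in> D_space \<xi> \<longleftrightarrow> inner \<xi> y = 0" for y
    unfolding D_space_def U_space_def orthogonal_comp_def real_inner_class.orthogonal_def
    by (auto simp: span_singleton intro: exI[of _ 1] dest: spec[of _ 1])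
  have n1: "inner \<xi> \<xi> = 1"
    using assms(2) by (simp add: norm_eq_1)
  have "x = 0" if "A x = 0" for x
  proof -
    define y where "y = x - inner \<xi> x *\<^sub>R \<xi>"
    have y: "y \<in> D_space \<xi>"
      by (simp add: mem y_def inner_diff_right n1)
    then have Ay: "inner \<xi> (A y) = 0"
      using D mem by blast
    have "A y = - (inner \<xi> x *\<^sub>R \<xi>)"
      using that by (simp add: y_def A.diff A.scale Axi)
    with Ay have "inner \<xi> x = 0"
      by (simp add: n1)
    then have "A y = 0" "y = x"
      using \<open>A y = _\<close> by (simp_all add: y_def)
    with iso[OF y] show ?thesis by simp
  qed
  then have "inj A"
    by (simp add: A.inj_iff_eq_0)
  then show ?thesis
    using lin by (simp add: bij_def linear_injective_imp_surjective)
qed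

definition SO_submodule :: "'v::euclidean_space \<Rightarrow> 'v tensor set \<Rightarrow> bool" where
  "SO_submodule \<xi> M \<longleftrightarrow> subspace M \<and> (\<forall>A\<in>SO_D \<xi>. \<forall>S\<in>M. tensor_action A S \<in> M)"

definition SO_irreducible :: "'v::euclidean_space \<Rightarrow> 'v tensor set \<Rightarrow> bool" where
  "SO_irreducible \<xi> M \<longleftrightarrow> SO_submodule \<xi> M \<and> M \<noteq> {0} \<and>
     (\<forall>N. SO_submodule \<xi> N \<and> N \<subseteq> M \<longrightarrow> N = {0} \<or> N = M)"

end

theory Submission
  imports Defs
begin

text \<open>
  Write \<open>T \<eta>\<close> (\<open>vertical_tensor \<xi> \<eta>\<close> below) for the tensor \<open>(X, Y) \<mapsto> g(X,\<xi>) g(Y,\<eta>) \<xi>\<close>. A decomposable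
  tensor in \<open>U\<^sup>* \<otimes> D\<^sup>* \<otimes> U\<^sup>*\<close> is \<open>T \<eta>\<close> for some \<open>\<eta> \<in> D\<close>, and \<open>T\<close> is linear, so
  \<open>U\<^sup>* \<otimes> D\<^sup>* \<otimes> U\<^sup>* = T ` D\<close> (\<open>S1U_space_eq_image\<close>), which is the explicit expression. Moreover
  \<open>A \<cdot> T \<eta> = T (A \<eta>)\<close> for \<open>A \<in> SO(D)\<close> (\<open>tensor_action_vertical_tensor\<close>), so \<open>T\<close> is an isomorphism
  from the standard representation \<open>D\<close>, and irreducibility becomes that of \<open>SO(n)\<close> acting on
  \<open>\<real>\<^sup>n\<close> for \<open>n \<ge> 1\<close>.

  That last fact is proved from very few elements of \<open>SO(D)\<close>. The determinant of an isometry is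
  \<open>\<plusminus>1\<close>, so the square of every isometry of \<open>V\<close> that fixes \<open>\<xi>\<close> lies in \<open>SO(D)\<close> (\<open>square_in_SO_D\<close>);
  no determinant has to be evaluated. If \<open>p, q \<in> D\<close> are orthonormal, the square of the rotation
  with cosine \<open>3/5\<close> and sine \<open>4/5\<close> in their plane sends \<open>p\<close> to \<open>-7/25 p + 24/25 q\<close>. An
  invariant subspace that contains \<open>p\<close> therefore contains every such \<open>q\<close>, and hence all of \<open>D\<close>
  (\<open>invariant_subspace_D_space\<close>). For \<open>n = 1\<close> there is no such \<open>q\<close>, and the argument is that
  \<open>D\<close> is a line.
\<close>

section \<open>Isometries that fix the unit vector\<close>

lemma mem_D_space_iff: "y \<in> D_space \<xi> \<longleftrightarrow> inner \<xi> y = 0"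
  unfolding D_space_def U_space_def orthogonal_comp_def real_inner_class.orthogonal_def
  by (auto simp: span_singleton intro: exI[of _ 1] dest: spec[of _ 1])

lemma subspace_D_space: "subspace (D_space \<xi>)"
  by (auto simp: subspace_def mem_D_space_iff inner_add_right)

lemma diff_proj_mem_D_space:
  assumes "norm \<xi> = 1"
  shows "x - inner \<xi> x *\<^sub>R \<xi> \<in> D_space \<xi>"
  using assms by (simp add: mem_D_space_iff inner_diff_right norm_eq_1)

text \<open>
  \<open>SO_D\<close> asks for the isometry property on \<open>D\<close> only; since \<open>V = U \<oplus> D\<close> is an orthogonal sum and
  \<open>A\<close> respects it, the property extends to \<open>V\<close>.
\<close>

lemma SO_D_imp_orthogonal_transformation:
  assumes "A \<in> SO_D \<xi>" "norm \<xi> = 1"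
  shows "orthogonal_transformation A"
proof -
  have lin: "linear A" and Axi: "A \<xi> = \<xi>" and D: "\<And>x. x \<in> D_space \<xi> \<Longrightarrow> A x \<in> D_space \<xi>"
    and iso: "\<And>x y. x \<in> D_space \<xi> \<Longrightarrow> y \<in> D_space \<xi> \<Longrightarrow> inner (A x) (A y) = inner x y"
    using assms(1) by (auto simp: SO_D_def)
  interpret A: linear A by fact
  have n1: "inner \<xi> \<xi> = 1"
    using assms(2) by (simp add: norm_eq_1)
  have "inner (A x) (A y) = inner x y" for x y
  proof -
    define a b where "a = x - inner \<xi> x *\<^sub>R \<xi>" and "b = y - inner \<xi> y *\<^sub>R \<xi>"
    have ab: "a \<in> D_space \<xi>" "b \<in> D_space \<xi>"
      using diff_proj_mem_D_space[OF assms(2)] by (auto simp: a_def b_def)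
    have orth: "inner \<xi> a = 0" "inner \<xi> b = 0" "inner \<xi> (A a) = 0" "inner \<xi> (A b) = 0"
      using ab D by (auto simp: mem_D_space_iff)
    then have orth': "inner a \<xi> = 0" "inner b \<xi> = 0" "inner (A a) \<xi> = 0" "inner (A b) \<xi> = 0"
      by (simp_all add: inner_commute)
    have xy: "x = a + inner \<xi> x *\<^sub>R \<xi>" "y = b + inner \<xi> y *\<^sub>R \<xi>"
      by (simp_all add: a_def b_def)
    have "inner (A x) (A y) = inner (A a) (A b) + inner \<xi> x * inner \<xi> y"
      by (subst xy(1), subst xy(2))
         (simp add: A.add A.scale Axi inner_add_left inner_add_right orth orth' n1)
    moreover have "inner x y = inner a b + inner \<xi> x * inner \<xi> y"
      by (subst xy(1), subst xy(2))
         (simp add: inner_add_left inner_add_right orth orth' n1)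
    ultimately show ?thesis
      using iso[OF ab] by simp
  qed
  with lin show ?thesis
    by (simp add: orthogonal_transformation_def)
qed

lemma orthonormal_frame_exists:
  fixes W :: "'v::euclidean_space set"
  assumes "subspace W"
  shows "\<exists>e. orthonormal_frame W e"
proof -
  obtain B where B: "B \<subseteq> W" "pairwise real_inner_class.orthogonal B"
      "\<And>x. x \<in> B \<Longrightarrow> norm x = 1" "independent B" "card B = dim W" "span B = W"
    using orthonormal_basis_subspace[OF assms] by metis
  have "finite B"
    using B(4) independent_imp_finite by blast
  then obtain e where e: "bij_betw e {0..<card B} B"
    using ex_bij_betw_nat_finite by blast
  have "inner (e i) (e j) = (if i = j then 1 else 0)" if "i < dim W" "j < dim W" for i j
  proof (cases "i = j")
    case True
    with that e B(3,5) show ?thesis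
      by (auto simp: bij_betw_def norm_eq_1[symmetric])
  next
    case False
    then have "e i \<noteq> e j" "e i \<in> B" "e j \<in> B"
      using that e B(5) by (auto simp: bij_betw_def inj_on_def)
    with False B(2) show ?thesis
      by (simp add: pairwise_def real_inner_class.orthogonal_def)
  qed
  moreover have "span (e ` {..<dim W}) = W"
    using e B(5,6) by (simp add: bij_betw_def atLeast0LessThan)
  ultimately show ?thesis
    unfolding orthonormal_frame_def by blast
qed

lemma orthonormal_frame_mem:
  assumes "orthonormal_frame W e" "i < dim W"
  shows "e i \<in> W"
  using assms span_base[of "e i" "e ` {..<dim W}"] by (auto simp: orthonormal_frame_def)

lemma orthonormal_frame_expansion:
  fixes W :: "'v::euclidean_space set"
  assumes "orthonormal_frame W e" "x \<in> W"
  shows "(\<Sum>k<dim W. inner (e k) x *\<^sub>R e k) = x"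
proof -
  have on: "\<And>i j. i < dim W \<Longrightarrow> j < dim W \<Longrightarrow> inner (e i) (e j) = (if i = j then 1 else 0)"
    and x: "x \<in> span (e ` {..<dim W})"
    using assms by (auto simp: orthonormal_frame_def)
  from x show ?thesis
  proof (induction rule: span_induct)
    case base
    show ?case
      by (auto simp: subspace_def inner_add_right scaleR_add_left sum.distrib
          scaleR_sum_right[symmetric] simp flip: scaleR_scaleR)
  next
    case (step x)
    then obtain j where j: "j < dim W" "x = e j" by auto
    have "(\<Sum>k<dim W. inner (e k) x *\<^sub>R e k) = (\<Sum>k<dim W. if k = j then e j else 0)"
      by (rule sum.cong) (use j on in auto)
    with j show ?case by simp
  qed
qed

lemma inner_orthonormal_frame_expansion:
  fixes W :: "'v::euclidean_space set"
  assumes "orthonormal_frame W e" "x \<in> W"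
  shows "inner z x = (\<Sum>k<dim W. inner (e k) x * inner z (e k))"
  by (subst orthonormal_frame_expansion[OF assms, symmetric]) (simp add: inner_sum_right)

lemma frame_matrix_compose:
  fixes W :: "'v::euclidean_space set"
  assumes e: "orthonormal_frame W e" and A: "linear A" and B: "B ` W \<subseteq> W"
  shows "frame_matrix W e (A \<circ> B) = frame_matrix W e A * frame_matrix W e B"
proof (rule eq_matI)
  fix i j
  assume "i < dim_row (frame_matrix W e A * frame_matrix W e B)"
    and "j < dim_col (frame_matrix W e A * frame_matrix W e B)"
  then have ij: "i < dim W" "j < dim W"
    by (simp_all add: frame_matrix_def)
  have "B (e j) \<in> W"
    using orthonormal_frame_mem[OF e ij(2)] B by auto
  then have "A (B (e j)) = (\<Sum>k<dim W. inner (e k) (B (e j)) *\<^sub>R A (e k))"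
    by (subst orthonormal_frame_expansion[OF e, symmetric])
       (simp_all add: linear_sum[OF A] linear_cmul[OF A])
  then show "frame_matrix W e (A \<circ> B) $$ (i, j) = (frame_matrix W e A * frame_matrix W e B) $$ (i, j)"
    using ij by (simp add: frame_matrix_def scalar_prod_def inner_sum_right atLeast0LessThan mult.commute)
qed (simp_all add: frame_matrix_def)

lemma det_frame_matrix_isometry:
  fixes W :: "'v::euclidean_space set"
  assumes e: "orthonormal_frame W e" and B: "B ` W \<subseteq> W"
    and iso: "\<And>x y. x \<in> W \<Longrightarrow> y \<in> W \<Longrightarrow> inner (B x) (B y) = inner x y"
  shows "Determinant.det (frame_matrix W e B) * Determinant.det (frame_matrix W e B) = 1"
proof -
  let ?M = "frame_matrix W e B"
  have M: "?M \<in> carrier_mat (dim W) (dim W)"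
    by (simp add: frame_matrix_def)
  have "transpose_mat ?M * ?M = 1\<^sub>m (dim W)"
  proof (rule eq_matI)
    fix i j
    assume "i < dim_row (1\<^sub>m (dim W) :: real mat)" "j < dim_col (1\<^sub>m (dim W) :: real mat)"
    then have ij: "i < dim W" "j < dim W" by simp_all
    have mem: "e i \<in> W" "e j \<in> W" "B (e j) \<in> W"
      using orthonormal_frame_mem[OF e] ij B by auto
    have "(\<Sum>k<dim W. inner (e k) (B (e i)) * inner (e k) (B (e j))) = inner (B (e i)) (B (e j))"
      by (subst inner_orthonormal_frame_expansion[OF e mem(3)])
         (simp add: inner_commute mult.commute)
    also have "\<dots> = (if i = j then 1 else 0)"
      using iso[OF mem(1,2)] e ij by (simp add: orthonormal_frame_def)
    finally show "(transpose_mat ?M * ?M) $$ (i, j) = 1\<^sub>m (dim W) $$ (i, j)"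
      using ij by (simp add: frame_matrix_def scalar_prod_def atLeast0LessThan)
  qed (simp_all add: frame_matrix_def)
  then have "Determinant.det (transpose_mat ?M * ?M) = 1" by simp
  then show ?thesis
    using det_mult[of "transpose_mat ?M" "dim W" ?M] M by (simp add: Determinant.det_transpose)
qed

text \<open>
  Squares supply enough elements of \<open>SO(D)\<close>: the determinant of a square is the square of a
  determinant \<open>\<plusminus>1\<close>, in any frame.
\<close>

lemma square_in_SO_D:
  assumes B: "orthogonal_transformation B" and fix_xi: "B \<xi> = \<xi>"
  shows "B \<circ> B \<in> SO_D \<xi>"
proof -
  have lin: "linear B" and iso: "\<And>x y. inner (B x) (B y) = inner x y"
    using B by (auto simp: orthogonal_transformation_def)
  have D: "B ` D_space \<xi> \<subseteq> D_space \<xi>"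
  proof clarify
    fix x assume "x \<in> D_space \<xi>"
    then show "B x \<in> D_space \<xi>"
      using iso[of \<xi> x] fix_xi by (simp add: mem_D_space_iff)
  qed
  obtain e where e: "orthonormal_frame (D_space \<xi>) e"
    using orthonormal_frame_exists[OF subspace_D_space] by blast
  let ?M = "frame_matrix (D_space \<xi>) e B"
  have M: "?M \<in> carrier_mat (dim (D_space \<xi>)) (dim (D_space \<xi>))"
    by (simp add: frame_matrix_def)
  have "Determinant.det (frame_matrix (D_space \<xi>) e (B \<circ> B)) = 1"
    using frame_matrix_compose[OF e lin D] det_mult[OF M M] det_frame_matrix_isometry[OF e D iso]
    by simp
  with e have "\<exists>e. orthonormal_frame (D_space \<xi>) e \<and>
      Determinant.det (frame_matrix (D_space \<xi>) e (B \<circ> B)) = 1"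
    by blast
  then show ?thesis
    using lin D fix_xi by (auto simp: SO_D_def iso linear_compose)
qed

section \<open>Irreducibility of the standard representation\<close>

definition plane_rotation :: "real \<Rightarrow> real \<Rightarrow> 'v::real_inner \<Rightarrow> 'v \<Rightarrow> 'v \<Rightarrow> 'v" where
  "plane_rotation c s p q x =
     x + ((c - 1) * inner p x - s * inner q x) *\<^sub>R p + (s * inner p x + (c - 1) * inner q x) *\<^sub>R q"

lemma orthogonal_transformation_plane_rotation:
  assumes cs: "c\<^sup>2 + s\<^sup>2 = 1" and pq: "inner p p = 1" "inner q q = 1" "inner p q = 0"
  shows "orthogonal_transformation (plane_rotation c s p q)"
  unfolding orthogonal_transformation_def
proof (intro conjI allI)
  show "linear (plane_rotation c s p q)"
    by (rule linearI) (simp_all add: plane_rotation_def algebra_simps inner_add_right)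
next
  fix x y
  have qp: "inner q p = 0" using pq(3) by (simp add: inner_commute)
  define a b a' b' where "a = inner p x" and "b = inner q x" and "a' = inner p y" and "b' = inner q y"
  have comm: "inner x p = a" "inner x q = b"
    by (simp_all add: a_def b_def inner_commute)
  define u v u' v' where "u = (c - 1) * a - s * b" and "v = s * a + (c - 1) * b"
    and "u' = (c - 1) * a' - s * b'" and "v' = s * a' + (c - 1) * b'"
  have "inner (plane_rotation c s p q x) (plane_rotation c s p q y)
      = inner x y + u' * a + v' * b + u * a' + v * b' + u * u' + v * v'"
    unfolding plane_rotation_def a_def[symmetric] b_def[symmetric] a'_def[symmetric] b'_def[symmetric]
      u_def[symmetric] v_def[symmetric] u'_def[symmetric] v'_def[symmetric]
    by (simp add: inner_add_left inner_add_right pq qp comm algebra_simps flip: a'_def b'_def)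
  also have "u' * a + v' * b + u * a' + v * b' + u * u' + v * v' = (c\<^sup>2 + s\<^sup>2 - 1) * (a * a' + b * b')"
    unfolding u_def v_def u'_def v'_def by (simp add: algebra_simps power2_eq_square)
  then have "inner x y + u' * a + v' * b + u * a' + v * b' + u * u' + v * v' = inner x y"
    using cs by simp
  finally show "inner (plane_rotation c s p q x) (plane_rotation c s p q y) = inner x y" .
qed

text \<open>
  Any rotation angle whose double has nonzero sine would do; \<open>3/5\<close> and \<open>4/5\<close> keep the
  coefficients rational.
\<close>

lemma invariant_subspace_contains_orthogonal_unit:
  assumes P: "subspace P" and inv: "\<forall>A\<in>SO_D \<xi>. \<forall>x\<in>P. A x \<in> P"
    and p: "p \<in> P" "p \<in> D_space \<xi>" "inner p p = 1"
    and q: "q \<in> D_space \<xi>" "inner q q = 1" "inner p q = 0"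
  shows "q \<in> P"
proof -
  let ?R = "plane_rotation (3/5) (4/5) p q"
  have "orthogonal_transformation ?R"
    by (rule orthogonal_transformation_plane_rotation)
       (use p q in \<open>simp_all add: power2_eq_square\<close>)
  moreover have "?R \<xi> = \<xi>"
    using p q by (simp add: plane_rotation_def mem_D_space_iff inner_commute)
  ultimately have "?R (?R p) \<in> P"
    using inv square_in_SO_D p(1) by fastforce
  moreover have qp: "inner q p = 0"
    using q(3) by (simp add: inner_commute)
  have "?R p = (3/5) *\<^sub>R p + (4/5) *\<^sub>R q"
    using p(3) qp by (simp add: plane_rotation_def algebra_simps flip: scaleR_left_distrib)
  then have "?R (?R p) = - (7/25) *\<^sub>R p + (24/25) *\<^sub>R q"
    using p(3) q(2,3) qp
    by (simp add: plane_rotation_def inner_add_right)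
       (simp add: algebra_simps flip: scaleR_left_distrib)
  ultimately have "- (7/25) *\<^sub>R p + (24/25) *\<^sub>R q \<in> P"
    by simp
  from subspace_scale[OF P subspace_add[OF P this subspace_scale[OF P p(1)]]]
  have "(25/24) *\<^sub>R ((- (7/25) *\<^sub>R p + (24/25) *\<^sub>R q) + (7/25) *\<^sub>R p) \<in> P" .
  moreover have "(25/24) *\<^sub>R ((- (7/25) *\<^sub>R p + (24/25) *\<^sub>R q) + (7/25) *\<^sub>R p) = q"
    unfolding scaleR_minus_left by simp
  ultimately show ?thesis by simp
qed

text \<open>
  The standard representation is irreducible: once an invariant subspace contains a unit vector
  \<open>p\<close>, every vector of \<open>D\<close> splits into a multiple of \<open>p\<close> and a multiple of a unit vector
  orthogonal to \<open>p\<close>.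
\<close>

lemma invariant_subspace_D_space:
  assumes P: "subspace P" and inv: "\<forall>A\<in>SO_D \<xi>. \<forall>x\<in>P. A x \<in> P"
    and sub: "P \<subseteq> D_space \<xi>" and ne: "P \<noteq> {0}"
  shows "P = D_space \<xi>"
proof
  show "D_space \<xi> \<subseteq> P"
  proof
    fix z assume z: "z \<in> D_space \<xi>"
    obtain x where x: "x \<in> P" "x \<noteq> 0"
      using ne subspace_0[OF P] by blast
    define p where "p = (1 / norm x) *\<^sub>R x"
    have p: "p \<in> P" "p \<in> D_space \<xi>" "inner p p = 1"
      using x P sub by (auto simp: p_def subspace_scale norm_eq_1[symmetric] simp del: inner_scaleR_left inner_scaleR_right)
    define w where "w = z - inner p z *\<^sub>R p"
    have w: "w \<in> D_space \<xi>" "inner p w = 0"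
      using z p subspace_D_space[of \<xi>]
      by (auto simp: w_def subspace_diff subspace_scale inner_diff_right)
    have "w \<in> P"
    proof (cases "w = 0")
      case False
      define q where "q = (1 / norm w) *\<^sub>R w"
      have "inner q q = 1"
        using False by (simp add: q_def norm_eq_1[symmetric] del: inner_scaleR_left inner_scaleR_right)
      moreover have "q \<in> D_space \<xi>" "inner p q = 0"
        using w by (simp_all add: q_def subspace_scale[OF subspace_D_space])
      ultimately have "q \<in> P"
        using invariant_subspace_contains_orthogonal_unit[OF P inv p] by blast
      then have "norm w *\<^sub>R q \<in> P"
        using P by (rule subspace_scale[rotated])
      with False show ?thesis by (simp add: q_def)
    qed (use P in \<open>simp add: subspace_0\<close>)
    then have "w + inner p z *\<^sub>R p \<in> P"
      using P p(1) by (intro subspace_add subspace_scale)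
    then show "z \<in> P" by (simp add: w_def)
  qed
qed (rule sub)

section \<open>The tensors of the submodule\<close>

lift_definition vertical_tensor :: "'v::euclidean_space \<Rightarrow> 'v \<Rightarrow> 'v tensor" is
  "\<lambda>\<xi> \<eta> X. inner X \<xi> *\<^sub>R (blinfun_scaleR_left \<xi> o\<^sub>L blinfun_inner_right \<eta>)"
  by (intro bounded_linear_intros)

lemma vertical_tensor_apply:
  "blinfun_apply (blinfun_apply (vertical_tensor \<xi> \<eta>) X) Y = (inner X \<xi> * inner Y \<eta>) *\<^sub>R \<xi>"
  by (simp add: vertical_tensor.rep_eq blinfun.scaleR_left inner_commute)

lemma vertical_tensor_eqI:
  assumes "\<And>X Y Z. lower S X Y Z = inner X \<xi> * inner Y \<eta> * inner Z \<xi>"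
  shows "S = vertical_tensor \<xi> \<eta>"
proof (intro blinfun_eqI)
  fix X Y
  show "blinfun_apply (blinfun_apply S X) Y = blinfun_apply (blinfun_apply (vertical_tensor \<xi> \<eta>) X) Y"
    using assms[of X Y]
    by (intro vector_eq_rdot[THEN iffD1]) (auto simp: lower_def vertical_tensor_apply inner_commute)
qed

lemma lower_vertical_tensor:
  "lower (vertical_tensor \<xi> \<eta>) X Y Z = inner X \<xi> * inner Y \<eta> * inner Z \<xi>"
  by (simp add: lower_def vertical_tensor_apply inner_commute)

lemma linear_vertical_tensor: "linear (vertical_tensor \<xi>)"
  by (rule linearI; intro blinfun_eqI)
     (simp_all add: vertical_tensor_apply blinfun.add_left blinfun.scaleR_left algebra_simps inner_add_right)

lemma vertical_tensor_eq_0_iff: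
  assumes "norm \<xi> = 1"
  shows "vertical_tensor \<xi> \<eta> = 0 \<longleftrightarrow> \<eta> = 0"
proof
  assume "vertical_tensor \<xi> \<eta> = 0"
  then have "lower (vertical_tensor \<xi> \<eta>) \<xi> \<eta> \<xi> = 0"
    by (simp add: lower_def)
  with assms show "\<eta> = 0"
    by (simp add: lower_vertical_tensor norm_eq_1)
qed (simp add: linear_0[OF linear_vertical_tensor])

text \<open>
  The span of the decomposable tensors is already their set, because two of the three factors
  are at most one-dimensional: in \<open>g(a \<xi>, \<cdot>) \<otimes> g(d, \<cdot>) \<otimes> g(c \<xi>, \<cdot>)\<close> the scalars can be moved into \<open>d\<close>.
\<close>

lemma S1U_space_eq_image: "S1U_space \<xi> = vertical_tensor \<xi> ` D_space \<xi>"
proof -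
  let ?T = "{S. \<exists>\<alpha>\<in>dual_space (U_space \<xi>). \<exists>\<beta>\<in>dual_space (D_space \<xi>). \<exists>\<gamma>\<in>dual_space (U_space \<xi>).
     \<forall>X Y Z. lower S X Y Z = blinfun_apply \<alpha> X * blinfun_apply \<beta> Y * blinfun_apply \<gamma> Z}"
  have "?T = vertical_tensor \<xi> ` D_space \<xi>"
  proof (intro equalityI subsetI)
    fix S assume "S \<in> ?T"
    then obtain \<alpha> \<beta> \<gamma> where "\<alpha> \<in> dual_space (U_space \<xi>)" "\<beta> \<in> dual_space (D_space \<xi>)"
        "\<gamma> \<in> dual_space (U_space \<xi>)"
      and S': "\<And>X Y Z. lower S X Y Z = blinfun_apply \<alpha> X * blinfun_apply \<beta> Y * blinfun_apply \<gamma> Z"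
      by blast
    then obtain a d c where d: "d \<in> D_space \<xi>"
      and forms: "\<And>X. blinfun_apply \<alpha> X = inner (a *\<^sub>R \<xi>) X" "\<And>Y. blinfun_apply \<beta> Y = inner d Y"
        "\<And>Z. blinfun_apply \<gamma> Z = inner (c *\<^sub>R \<xi>) Z"
      unfolding dual_space_def U_space_def span_singleton by blast
    note S = S'[unfolded forms]
    have "S = vertical_tensor \<xi> ((a * c) *\<^sub>R d)"
      by (rule vertical_tensor_eqI) (simp add: S inner_commute)
    moreover have "(a * c) *\<^sub>R d \<in> D_space \<xi>"
      using d subspace_D_space subspace_scale by blast
    ultimately show "S \<in> vertical_tensor \<xi> ` D_space \<xi>" by blast
  next
    fix S assume "S \<in> vertical_tensor \<xi> ` D_space \<xi>"
    then obtain \<eta> where \<eta>: "\<eta> \<in> D_space \<xi>" "S = vertical_tensor \<xi> \<eta>" by blast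
    have "blinfun_inner_right \<xi> \<in> dual_space (U_space \<xi>)"
      by (auto simp: dual_space_def U_space_def span_base intro!: bexI[of _ \<xi>])
    moreover have "blinfun_inner_right \<eta> \<in> dual_space (D_space \<xi>)"
      using \<eta>(1) by (auto simp: dual_space_def)
    ultimately show "S \<in> ?T"
      unfolding mem_Collect_eq
      by (intro bexI[of _ "blinfun_inner_right \<xi>"] bexI[of _ "blinfun_inner_right \<eta>"])
         (auto simp: \<eta>(2) lower_vertical_tensor inner_commute)
  qed
  moreover have "subspace (vertical_tensor \<xi> ` D_space \<xi>)"
    using linear_vertical_tensor subspace_D_space by (rule linear_subspace_image)
  ultimately show ?thesis
    unfolding S1U_space_def tensor3_def by (simp add: span_eq_iff)
qed

lemma vertical_tensor_mem_S_space:
  assumes "\<eta> \<in> D_space \<xi>"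
  shows "vertical_tensor \<xi> \<eta> \<in> S_space \<xi>"
  using assms
  by (auto simp: S_space_def derivation_action_def vertical_tensor_apply mem_D_space_iff inner_commute
      intro!: ext)

section \<open>The action on tensors\<close>

lemma orthogonal_transformation_inner_inv:
  fixes A :: "'v::euclidean_space \<Rightarrow> 'v"
  assumes "orthogonal_transformation A"
  shows "inner (inv_into UNIV A x) y = inner x (A y)"
proof -
  have "A (inv_into UNIV A x) = x"
    using orthogonal_transformation_surj[OF assms] by (simp add: surj_f_inv_f)
  then show ?thesis
    using assms by (metis orthogonal_transformation_def)
qed

lemma tensor_action_SO_D_apply:
  assumes "A \<in> SO_D \<xi>" "norm \<xi> = 1"
  shows "blinfun_apply (blinfun_apply (tensor_action A S) X) Y =
    A (blinfun_apply (blinfun_apply S (inv_into UNIV A X)) (inv_into UNIV A Y))"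
  using assms SO_D_bij[OF assms] by (intro tensor_action_apply) (auto simp: SO_D_def)

text \<open>\<open>T\<close> intertwines the standard action on \<open>D\<close> with the action on tensors, since \<open>A\<close> fixes \<open>\<xi>\<close>.\<close>

lemma tensor_action_vertical_tensor:
  assumes A: "A \<in> SO_D \<xi>" "norm \<xi> = 1"
  shows "tensor_action A (vertical_tensor \<xi> \<eta>) = vertical_tensor \<xi> (A \<eta>)"
proof (intro blinfun_eqI)
  fix X Y
  have "linear A" "A \<xi> = \<xi>" using A by (auto simp: SO_D_def)
  then show "blinfun_apply (blinfun_apply (tensor_action A (vertical_tensor \<xi> \<eta>)) X) Y =
      blinfun_apply (blinfun_apply (vertical_tensor \<xi> (A \<eta>)) X) Y"
    by (simp add: tensor_action_SO_D_apply[OF A] vertical_tensor_apply linear_cmul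
        orthogonal_transformation_inner_inv[OF SO_D_imp_orthogonal_transformation[OF A]])
qed

lemma subspace_S_space: "subspace (S_space \<xi>)"
proof -
  have "S + S' \<in> S_space \<xi>" if "S \<in> S_space \<xi>" "S' \<in> S_space \<xi>" for S S'
    using that
    by (auto simp: S_space_def derivation_action_def fun_eq_iff blinfun.add_left inner_add_left
        inner_add_right; smt (verit))
  moreover have "c *\<^sub>R S \<in> S_space \<xi>" if "S \<in> S_space \<xi>" for c S
  proof -
    have "derivation_action (c *\<^sub>R T) inner Y Z = c * derivation_action T inner Y Z" for T and Y Z :: 'a
      by (simp add: derivation_action_def blinfun.scaleR_left right_diff_distrib)
    with that show ?thesis
      by (simp add: S_space_def blinfun.scaleR_left fun_eq_iff)
  qed
  moreover have "0 \<in> S_space \<xi>"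
    by (auto simp: S_space_def derivation_action_def)
  ultimately show ?thesis
    by (simp add: subspace_def)
qed

text \<open>
  Both defining conditions of \<open>\<S>(V)\<close> are natural: \<open>A\<^sup>-\<^sup>1\<close> preserves \<open>D\<close> and fixes \<open>\<xi>\<close>, and it is
  the adjoint of \<open>A\<close>, so conjugating a skew endomorphism by \<open>A\<close> leaves it skew.
\<close>

lemma SO_submodule_S_space:
  fixes \<xi> :: "'v::euclidean_space"
  assumes "norm \<xi> = 1"
  shows "SO_submodule \<xi> (S_space \<xi>)"
  unfolding SO_submodule_def
proof (intro conjI ballI subspace_S_space)
  fix A and S :: "'v tensor" assume A: "A \<in> SO_D \<xi>" and S: "S \<in> S_space \<xi>"
  note ortho = SO_D_imp_orthogonal_transformation[OF A assms]
  note inner_inv = orthogonal_transformation_inner_inv[OF ortho]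
  have Axi: "A \<xi> = \<xi>" and lin: "linear A" using A by (auto simp: SO_D_def)
  have invxi: "inv_into UNIV A \<xi> = \<xi>"
    using Axi orthogonal_transformation_inj[OF ortho] by (metis inv_f_f)
  have inner_A: "inner (A x) y = inner x (inv_into UNIV A y)" for x y
    using inner_inv[of y x] by (simp add: inner_commute)
  show "tensor_action A S \<in> S_space \<xi>"
    unfolding S_space_def mem_Collect_eq
  proof (intro conjI ballI ext)
    fix X Y Z assume "X \<in> D_space \<xi>"
    then have "inv_into UNIV A X \<in> D_space \<xi>"
      using inner_inv[of X \<xi>] Axi by (simp add: mem_D_space_iff inner_commute)
    then have "derivation_action (blinfun_apply S (inv_into UNIV A X)) inner (inv_into UNIV A Y) (inv_into UNIV A Z) = 0"
      using S by (simp add: S_space_def)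
    then show "derivation_action (blinfun_apply (tensor_action A S) X) inner Y Z = 0"
      by (simp add: derivation_action_def tensor_action_SO_D_apply[OF A assms] inner_A flip: inner_inv)
  next
    show "blinfun_apply (blinfun_apply (tensor_action A S) \<xi>) \<xi> = 0"
      using S by (simp add: tensor_action_SO_D_apply[OF A assms] invxi S_space_def linear_0[OF lin])
  qed
qed

text \<open>
  A submodule \<open>N\<close> is pulled back along \<open>T\<close> to an invariant subspace of \<open>D\<close>. The bound on the
  dimension makes \<open>D\<close>, and so the module, nonzero.
\<close>

lemma SO_irreducible_S1U_space:
  fixes \<xi> :: "'v::euclidean_space"
  assumes \<xi>: "norm \<xi> = 1" and dim: "DIM('v) \<ge> 2"
  shows "SO_irreducible \<xi> (S1U_space \<xi>)"
  unfolding SO_irreducible_def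
proof (intro conjI allI impI)
  show "SO_submodule \<xi> (S1U_space \<xi>)"
    unfolding SO_submodule_def S1U_space_eq_image
  proof (intro conjI ballI)
    show "subspace (vertical_tensor \<xi> ` D_space \<xi>)"
      using linear_vertical_tensor subspace_D_space by (rule linear_subspace_image)
  next
    fix A S assume A: "A \<in> SO_D \<xi>" and "S \<in> vertical_tensor \<xi> ` D_space \<xi>"
    then obtain \<eta> where "\<eta> \<in> D_space \<xi>" "S = vertical_tensor \<xi> \<eta>" by blast
    with A show "tensor_action A S \<in> vertical_tensor \<xi> ` D_space \<xi>"
      by (auto simp: tensor_action_vertical_tensor[OF A \<xi>] SO_D_def)
  qed
next
  obtain \<eta> where \<eta>: "\<eta> \<noteq> 0" "real_inner_class.orthogonal \<xi> \<eta>"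
    using orthogonal_to_vector_exists[OF dim] by blast
  then have "vertical_tensor \<xi> \<eta> \<in> S1U_space \<xi>" "vertical_tensor \<xi> \<eta> \<noteq> 0"
    by (auto simp: S1U_space_eq_image mem_D_space_iff real_inner_class.orthogonal_def
        vertical_tensor_eq_0_iff[OF \<xi>])
  then show "S1U_space \<xi> \<noteq> {0}" by blast
next
  fix N assume "SO_submodule \<xi> N \<and> N \<subseteq> S1U_space \<xi>"
  then have N: "subspace N" "\<And>A S. A \<in> SO_D \<xi> \<Longrightarrow> S \<in> N \<Longrightarrow> tensor_action A S \<in> N"
      and sub: "N \<subseteq> vertical_tensor \<xi> ` D_space \<xi>"
    by (auto simp: SO_submodule_def S1U_space_eq_image)
  define P where "P = {\<eta> \<in> D_space \<xi>. vertical_tensor \<xi> \<eta> \<in> N}"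
  have N_eq: "N = vertical_tensor \<xi> ` P"
    using sub by (auto simp: P_def)
  have "P = D_space \<xi> \<inter> vertical_tensor \<xi> -` N"
    by (auto simp: P_def)
  then have "subspace P"
    using N(1) by (simp add: subspace_inter subspace_D_space linear_subspace_vimage linear_vertical_tensor)
  moreover have "A x \<in> P" if A: "A \<in> SO_D \<xi>" and x: "x \<in> P" for A x
  proof -
    have "A x \<in> D_space \<xi>"
      using A x by (auto simp: SO_D_def P_def)
    moreover have "vertical_tensor \<xi> (A x) \<in> N"
      using N(2)[OF A, of "vertical_tensor \<xi> x"] x by (simp add: P_def tensor_action_vertical_tensor[OF A \<xi>])
    ultimately show ?thesis by (simp add: P_def)
  qed
  moreover have "P \<subseteq> D_space \<xi>"
    by (auto simp: P_def)
  ultimately have "P = {0} \<or> P = D_space \<xi>"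
    using invariant_subspace_D_space by blast
  then show "N = {0} \<or> N = S1U_space \<xi>"
    by (auto simp: N_eq S1U_space_eq_image linear_0[OF linear_vertical_tensor])
qed

theorem proposition5p5:
  fixes \<xi> :: "'v::euclidean_space" and n :: nat
  assumes "n \<ge> 1" and "DIM('v) = n + 1" and "norm \<xi> = 1"
  shows "SO_submodule \<xi> (S_space \<xi>)
    \<and> S1U_space \<xi> \<subseteq> S_space \<xi>
    \<and> SO_irreducible \<xi> (S1U_space \<xi>)
    \<and> S1U_space \<xi> = {S \<in> S_space \<xi>. \<exists>\<eta>\<in>D_space \<xi>. \<forall>X Y Z.
         lower S X Y Z = inner Y \<eta> * inner X \<xi> * inner Z \<xi>}"
proof (intro conjI)
  show "SO_submodule \<xi> (S_space \<xi>)"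
    by (rule SO_submodule_S_space) fact
  show sub: "S1U_space \<xi> \<subseteq> S_space \<xi>"
    by (auto simp: S1U_space_eq_image vertical_tensor_mem_S_space)
  show "SO_irreducible \<xi> (S1U_space \<xi>)"
    by (rule SO_irreducible_S1U_space) (use assms in simp_all)
  show "S1U_space \<xi> = {S \<in> S_space \<xi>. \<exists>\<eta>\<in>D_space \<xi>. \<forall>X Y Z.
         lower S X Y Z = inner Y \<eta> * inner X \<xi> * inner Z \<xi>}"
  proof (intro equalityI subsetI)
    fix S assume "S \<in> S1U_space \<xi>"
    then show "S \<in> {S \<in> S_space \<xi>. \<exists>\<eta>\<in>D_space \<xi>. \<forall>X Y Z.
         lower S X Y Z = inner Y \<eta> * inner X \<xi> * inner Z \<xi>}"
      using sub by (auto simp: S1U_space_eq_image lower_vertical_tensor)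
  next
    fix S assume "S \<in> {S \<in> S_space \<xi>. \<exists>\<eta>\<in>D_space \<xi>. \<forall>X Y Z.
         lower S X Y Z = inner Y \<eta> * inner X \<xi> * inner Z \<xi>}"
    then obtain \<eta> where \<eta>: "\<eta> \<in> D_space \<xi>"
      and S: "\<And>X Y Z. lower S X Y Z = inner Y \<eta> * inner X \<xi> * inner Z \<xi>"
      by blast
    have "S = vertical_tensor \<xi> \<eta>"
      by (rule vertical_tensor_eqI) (simp add: S)
    with \<eta> show "S \<in> S1U_space \<xi>"
      by (simp add: S1U_space_eq_image)
  qed
qed

end
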